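(* Let $\Theta$ and $\mathcal C$ be the polyhedra $\Theta=\{x\in\mathbb R^n\mid \langle a_i,x\rangle\le b_i\ \forall i\in I_1\}$ and $\mathcal C=\{x\in\mathbb R^n\mid \langle a_i,x\rangle\le 0\ \forall i\in I_2\}$, and let $\mathcal N$ be the normal cone mapping to $\Theta$. Let $\bar x\in\mathcal C$ and $(\bar x,\bar x^* )\in\operatorname{gph}\mathcal N$. Assume that the generating vectors $a_i$, $i\in I(\bar x)$, are linearly independent. Then the limiting normal cone with respect to $\mathcal C\times\mathbb R^n$ of $\operatorname{gph}\mathcal N$ at $(\bar x,\bar x^* )$ is $$N_{\mathcal C\times\mathbb R^n}((\bar x,\bar x^* ),\operatorname{gph}\mathcal N)=\bigcup_{\substack{Q\subset\bar I\\ \tilde I\subset P\subset Q|_{I_1}}}(A_{Q,P}\cap\mathcal T_{Q|_{I_2}})\times B_{Q|_{I_1},P},$$ where $\bar I:=I(\bar x)$ and $\tilde I:=\mathcal I(\bar x,\bar x^* )$.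
   Context: Setting: $I_1=\{1,\dots,\ell_1\}$, $I_2=\{\ell_1+1,\dots,\ell\}$, $I=I_1\cup I_2$; $a_i\in\mathbb R^n$ for $i\in I$ and $b_i\in\mathbb R$ for $i\in I_1$. Active index sets: $I_1(x)=\{i\in I_1\mid\langle a_i,x\rangle=b_i\}$ for $x\in\Theta$; $I_2(x)=\{i\in I_2\mid\langle a_i,x\rangle=0\}$ for $x\in\mathcal C$; $I(x)=I_1(x)\cup I_2(x)$ for $x\in\Theta\cap\mathcal C$. Normal cone mapping: $\mathcal N(x)=N(x,\Theta)$ (the usual normal cone to the convex set $\Theta$, equal to $\operatorname{cone}\{a_i\mid i\in I_1(x)\}$) if $x\in\Theta$, and $\mathcal N(x)=\emptyset$ otherwise; $\operatorname{gph}\mathcal N=\{(x,x^* )\mid x^*\in\mathcal N(x)\}$. Index set $\mathcal I(\bar x,\bar x^* )$: since $\bar x^*\in N(\bar x,\Theta)$, there are a set $\mathcal I\subset I_1(\bar x)$ and numbers $\lambda_i\ge 0$ ($i\in\mathcal I$) with $\bar x^*=\sum_{i\in\mathcal I}\lambda_ia_i$; fixing such a representation, $\mathcal I(\bar x,\bar x^* ):=\{i\in\mathcal I\mid\lambda_i>0\}$. For $Q\subset I$: $Q|_{I_j}=Q\cap I_j$ ($j=1,2$), $\mathcal T_Q=\{u\in\mathbb R^n\mid\langle a_i,u\rangle\le 0\ \forall i\in Q\}$. For $P\subset Q\subset I$ with $P\subset I_1$: $B_{Q,P}=\{u\in\mathcal T_Q\mid\langle a_i,u\rangle=0\ \forall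 i\in P\}$, $A_{Q,P}=\operatorname{cone}\{a_i\mid i\in Q\setminus P\}+\operatorname{span}\{a_i\mid i\in P\}$. Here $\operatorname{cone}$ is the convex cone generated (nonnegative combinations), $\operatorname{cone}\emptyset=\operatorname{span}\emptyset=\{0\}$, $\mathcal T_\emptyset=\mathbb R^n$. Normal cones with respect to a set: for nonempty $\Omega,\mathcal D\subset\mathbb R^s$ with $\mathcal D$ closed and convex, and $\bar z\in\Omega\cap\mathcal D$, $$\hat N_{\mathcal D}(\bar z,\Omega)=\Big\{z^*\ \Big|\ \exists p>0:\ \bar z+pz^*\in\mathcal D,\ \limsup_{z\to\bar z,\ z\in\Omega\cap\mathcal D}\frac{\langle z^*,z-\bar z\rangle}{\|z-\bar z\|}\le 0\Big\}$$ (Fréchet), and the limiting normal cone $N_{\mathcal D}(\bar z,\Omega)$ is the set of all $z^*$ for which there exist $z_k\to\bar z$ with $z_k\in\Omega\cap\mathcal D$ and $z_k^*\to z^*$ with $z_k^*\in\hat N_{\mathcal D}(z_k,\Omega)$. *)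

theory Defs
  imports "HOL-Analysis.Analysis"
begin

definition polyhedral_set :: "(nat \<Rightarrow> 'a::real_inner) \<Rightarrow> (nat \<Rightarrow> real) \<Rightarrow> nat set \<Rightarrow> 'a set" where
  "polyhedral_set a b K = {x. \<forall>i\<in>K. a i \<bullet> x \<le> b i}"

definition active :: "(nat \<Rightarrow> 'a::real_inner) \<Rightarrow> (nat \<Rightarrow> real) \<Rightarrow> nat set \<Rightarrow> 'a \<Rightarrow> nat set" where
  "active a b K x = {i\<in>K. a i \<bullet> x = b i}"

definition normal_cone_map :: "'a::real_inner set \<Rightarrow> 'a \<Rightarrow> 'a set" where
  "normal_cone_map S x = (if x \<in> S then {v. \<forall>y\<in>S. v \<bullet> (y - x) \<le> 0} else {})"

definition gph :: "('a \<Rightarrow> 'b set) \<Rightarrow> ('a \<times> 'b) set" where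
  "gph F = {(x, y). y \<in> F x}"

text \<open>Normal cones with respect to a set \<open>D\<close>. At an isolated point of \<open>\<Omega> \<inter> D\<close> the filter is
  trivial, so the upper limit is \<open>-\<infinity>\<close> and the limit condition holds.\<close>

definition frechet_normal_wrt :: "'a::real_inner set \<Rightarrow> 'a \<Rightarrow> 'a set \<Rightarrow> 'a set" where
  "frechet_normal_wrt D z \<Omega> =
     {v. (\<exists>p>0. z + p *\<^sub>R v \<in> D) \<and>
         Limsup (at z within (\<Omega> \<inter> D)) (\<lambda>y. ereal (v \<bullet> (y - z) / norm (y - z))) \<le> 0}"

definition limiting_normal_wrt :: "'a::real_inner set \<Rightarrow> 'a \<Rightarrow> 'a set \<Rightarrow> 'a set" where
  "limiting_normal_wrt D z \<Omega> =
     {v. \<exists>zs vs. (\<forall>k::nat. zs k \<in> \<Omega> \<inter> D \<and> vs k \<in> frechet_normal_wrt D (zs k) \<Omega>) \<and>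
           zs \<longlonglongrightarrow> z \<and> vs \<longlonglongrightarrow> v}"

definition T_cone :: "(nat \<Rightarrow> 'a::real_inner) \<Rightarrow> nat set \<Rightarrow> 'a set" where
  "T_cone a Q = {u. \<forall>i\<in>Q. a i \<bullet> u \<le> 0}"

definition B_cone :: "(nat \<Rightarrow> 'a::real_inner) \<Rightarrow> nat set \<Rightarrow> nat set \<Rightarrow> 'a set" where
  "B_cone a Q P = {u \<in> T_cone a Q. \<forall>i\<in>P. a i \<bullet> u = 0}"

text \<open>\<open>convex_cone hull\<close> rather than \<open>cone hull\<close>: the latter takes only nonnegative
  multiples of single vectors. Both \<open>convex_cone hull {}\<close> and \<open>span {}\<close> are \<open>{0}\<close>.\<close>

definition A_cone :: "(nat \<Rightarrow> 'a::real_inner) \<Rightarrow> nat set \<Rightarrow> nat set \<Rightarrow> 'a set" where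
  "A_cone a Q P = {u + v | u v. u \<in> convex_cone hull (a ` (Q - P)) \<and> v \<in> span (a ` P)}"

end

theory Submission
  imports Defs
begin

text \<open>
  At a point \<open>(x, x\<^sup>*)\<close> of the graph with \<open>x \<in> C\<close>, let \<open>Q\<close> be the set of active indices of \<open>x\<close>
  and \<open>P\<close> the set of indices with positive multiplier in \<open>x\<^sup>*\<close>. Linear independence makes
  \<open>A\<^bsub>Q,P\<^esub>\<close> the polar of \<open>B\<^bsub>Q,P\<^esub>\<close>. Moving \<open>x\<close> along \<open>B\<^bsub>Q,P\<^esub>\<close> with \<open>x\<^sup>*\<close> fixed, or \<open>x\<^sup>*\<close> along
  \<open>a\<^sub>i\<close> with \<open>x\<close> fixed, stays in the graph; conversely, nearby graph points keep the
  multipliers in \<open>P\<close> positive. So the Frechet cone at \<open>(x, x\<^sup>*)\<close> is exactly the member of the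
  union indexed by \<open>(Q, P)\<close>. Only finitely many closed cones arise near the reference point, which
  bounds the limiting cone from above. For the other inclusion, every admissible pair \<open>(Q, P)\<close> is
  realised arbitrarily close to the reference point, since linear independence provides \<open>d\<close> with
  \<open>\<langle>a\<^sub>i, d\<rangle> = 0\<close> on \<open>Q\<close> and \<open>-1\<close> on the remaining active indices.
\<close>

section \<open>Duality for linearly independent vectors\<close>

text \<open>Values prescribed on an independent set extend to a linear functional, and
  \<open>adjoint g 1\<close> is the vector representing it. Injectivity lets the values depend on
  the index rather than on the vector.\<close>

lemma prescribed_inner_products:
  fixes a :: "nat \<Rightarrow> 'a::euclidean_space"
  assumes "inj_on a Q" and "independent (a ` Q)"
  shows "\<exists>d. \<forall>i\<in>Q. a i \<bullet> d = c i"
proof -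
  obtain g :: "'a \<Rightarrow> real" where g: "linear g" "\<forall>x\<in>a ` Q. g x = c (inv_into Q a x)"
    using linear_independent_extend[OF assms(2), of "\<lambda>x. c (inv_into Q a x)"] by auto
  have "a i \<bullet> adjoint g 1 = c i" if "i \<in> Q" for i
    using adjoint_works[OF g(1), of "a i" 1] g(2) that assms(1) by simp
  then show ?thesis by blast
qed

lemma finite_independent_family:
  fixes a :: "nat \<Rightarrow> 'a::euclidean_space"
  assumes "inj_on a Q" and "independent (a ` Q)"
  shows "finite Q"
  using assms finite_imageD independent_imp_finite by blast

text \<open>Split \<open>w\<close> into a part in the span of the \<open>a i\<close> and a part
  \<open>t\<close> orthogonal to that span. Since \<open>t\<close> itself lies in
  \<open>B_cone a Q P\<close>, polarity forces \<open>t \<bullet> t \<le> 0\<close>, so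
  \<open>w\<close> is in the span; dual vectors then test the signs of its coefficients.\<close>

lemma farkas_independent:
  fixes a :: "nat \<Rightarrow> 'a::euclidean_space"
  assumes inj: "inj_on a Q" and ind: "independent (a ` Q)" and "P \<subseteq> Q"
    and polar: "\<forall>u\<in>B_cone a Q P. w \<bullet> u \<le> 0"
  shows "\<exists>c. w = (\<Sum>i\<in>Q. c i *\<^sub>R a i) \<and> (\<forall>i\<in>Q - P. c i \<ge> 0)"
proof -
  have fin: "finite Q" using finite_independent_family[OF inj ind] .
  obtain s t where st: "s \<in> span (a ` Q)" "\<And>v. v \<in> span (a ` Q) \<Longrightarrow> orthogonal t v" "w = s + t"
    using orthogonal_subspace_decomp_exists[of "a ` Q" w] by blast
  have t0: "a i \<bullet> t = 0" if "i \<in> Q" for i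
    using st(2)[of "a i"] that span_base[of "a i" "a ` Q"] by (simp add: orthogonal_def inner_commute)
  then have "t \<in> B_cone a Q P"
    using assms(3) by (auto simp: B_cone_def T_cone_def)
  then have "w \<bullet> t \<le> 0" using polar by blast
  moreover have "s \<bullet> t = 0"
    using st(2)[OF st(1)] by (simp add: orthogonal_def inner_commute)
  ultimately have "t \<bullet> t \<le> 0" using st(3) by (simp add: inner_left_distrib)
  then have "t = 0" by (metis inner_gt_zero_iff not_less)
  then obtain q where "w = (\<Sum>v\<in>a ` Q. q v *\<^sub>R v)"
    using st(1,3) span_finite[of "a ` Q"] fin by auto
  then have w: "w = (\<Sum>i\<in>Q. q (a i) *\<^sub>R a i)"
    by (simp add: sum.reindex[OF inj])
  have "q (a j) \<ge> 0" if j: "j \<in> Q - P" for j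
  proof -
    \<comment> \<open>The negative of the vector dual to \<open>a j\<close>. It lies in
      \<open>B_cone a Q P\<close> because \<open>j\<close> is outside \<open>P\<close>, and its
      product with \<open>w\<close> is minus the coefficient in question.\<close>
    obtain d where d: "\<forall>i\<in>Q. a i \<bullet> d = (if i = j then -1 else 0)"
      using prescribed_inner_products[OF inj ind, of "\<lambda>i. if i = j then -1 else 0"] by blast
    have "d \<in> B_cone a Q P"
      using d j assms(3) by (auto simp: B_cone_def T_cone_def subset_iff)
    then have "w \<bullet> d \<le> 0" using polar by blast
    moreover have "w \<bullet> d = (\<Sum>i\<in>Q. if i = j then - q (a i) else 0)"
      unfolding w inner_sum_left by (intro sum.cong) (auto simp: d)
    ultimately show ?thesis using j fin by simp
  qed
  with w show ?thesis by (intro exI[of _ "\<lambda>i. q (a i)"]) blast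
qed

text \<open>One inclusion is checked on generators, the other is the Farkas property. The polar form
  is what the Frechet condition yields directly, and it exhibits the cone as an intersection of
  half-spaces.\<close>

lemma A_cone_eq_polar_B_cone:
  fixes a :: "nat \<Rightarrow> 'a::euclidean_space"
  assumes inj: "inj_on a Q" and ind: "independent (a ` Q)" and PQ: "P \<subseteq> Q"
  shows "A_cone a Q P = {w. \<forall>u\<in>B_cone a Q P. w \<bullet> u \<le> 0}"
proof (intro equalityI subsetI CollectI ballI)
  fix w u assume w: "w \<in> A_cone a Q P" and u: "u \<in> B_cone a Q P"
  obtain r s where rs: "w = r + s" "r \<in> convex_cone hull (a ` (Q - P))" "s \<in> span (a ` P)"
    using w by (auto simp: A_cone_def)
  have "convex_cone hull (a ` (Q - P)) \<subseteq> {v. u \<bullet> v \<le> 0}"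
  proof (rule hull_minimal)
    show "a ` (Q - P) \<subseteq> {v. u \<bullet> v \<le> 0}"
      using u by (auto simp: B_cone_def T_cone_def inner_commute)
    show "convex_cone {v. u \<bullet> v \<le> 0}" by (rule convex_cone_halfspace_le)
  qed
  then have "r \<bullet> u \<le> 0" using rs(2) by (auto simp: inner_commute)
  moreover have "u \<bullet> s = 0"
    using rs(3)
  proof (induction rule: span_induct)
    case base show ?case by (rule subspace_hyperplane)
  next
    case (step v) then show ?case using u by (auto simp: B_cone_def inner_commute)
  qed
  ultimately show "w \<bullet> u \<le> 0" using rs(1) by (simp add: inner_left_distrib inner_commute[of s])
next
  fix w assume "w \<in> {w. \<forall>u\<in>B_cone a Q P. w \<bullet> u \<le> 0}"
  then obtain c where c: "w = (\<Sum>i\<in>Q. c i *\<^sub>R a i)" "\<forall>i\<in>Q - P. c i \<ge> 0"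
    using farkas_independent[OF inj ind PQ] by blast
  have fin: "finite Q" using finite_independent_family[OF inj ind] .
  have hull: "(\<Sum>i\<in>R. c i *\<^sub>R a i) \<in> convex_cone hull (a ` (Q - P))" if "finite R" "R \<subseteq> Q - P" for R
    using that
  proof (induction R rule: finite_induct)
    case empty show ?case by (simp add: convex_cone_hull_contains_0)
  next
    case (insert i R)
    then have "c i *\<^sub>R a i \<in> convex_cone hull (a ` (Q - P))"
      using c(2) by (intro convex_cone_hull_mul hull_inc) auto
    then show ?case using insert by (simp add: convex_cone_hull_add)
  qed
  have "(\<Sum>i\<in>P. c i *\<^sub>R a i) \<in> span (a ` P)"
    by (intro span_sum span_scale span_base) auto
  moreover have "w = (\<Sum>i\<in>Q - P. c i *\<^sub>R a i) + (\<Sum>i\<in>P. c i *\<^sub>R a i)"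
    using c(1) sum.subset_diff[OF PQ fin] by simp
  ultimately show "w \<in> A_cone a Q P"
    unfolding A_cone_def using hull[of "Q - P"] fin by blast
qed

section \<open>Closedness of the cones\<close>

lemma closed_B_cone: "closed (B_cone a Q P)"
proof -
  have "B_cone a Q P = (\<Inter>i\<in>Q. {u. a i \<bullet> u \<le> 0}) \<inter> (\<Inter>i\<in>P. {u. a i \<bullet> u = 0})"
    by (auto simp: B_cone_def T_cone_def)
  then show ?thesis
    by (auto intro!: closed_Int closed_INT closed_halfspace_le closed_hyperplane)
qed

lemma closed_T_cone: "closed (T_cone a Q)"
  using closed_B_cone[of a Q "{}"] by (simp add: B_cone_def)

lemma closed_A_cone:
  fixes a :: "nat \<Rightarrow> 'a::euclidean_space"
  assumes "inj_on a Q" and "independent (a ` Q)" and "P \<subseteq> Q"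
  shows "closed (A_cone a Q P)"
proof -
  have "A_cone a Q P = (\<Inter>u\<in>B_cone a Q P. {w. u \<bullet> w \<le> 0})"
    using A_cone_eq_polar_B_cone[OF assms] by (auto simp: inner_commute)
  then show ?thesis by (auto intro!: closed_INT closed_halfspace_le)
qed

section \<open>Polyhedra near a given point\<close>

text \<open>By continuity an inactive constraint stays inactive near \<open>x\<close>, and finitely
  many constraints share a neighbourhood.\<close>

lemma eventually_active_subset:
  assumes "finite K"
  shows "\<forall>\<^sub>F y in nhds x. active a b K y \<subseteq> active a b K x"
proof -
  have "\<forall>\<^sub>F y in nhds x. a i \<bullet> x \<noteq> b i \<longrightarrow> a i \<bullet> y \<noteq> b i" for i
  proof (cases "a i \<bullet> x = b i")
    case False
    have "((\<lambda>y. a i \<bullet> y) \<longlongrightarrow> a i \<bullet> x) (nhds x)" by (intro tendsto_intros filterlim_ident)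
    then show ?thesis
      using False tendsto_imp_eventually_ne by (blast intro: eventually_mono)
  qed simp
  then have "\<forall>\<^sub>F y in nhds x. \<forall>i\<in>K. a i \<bullet> x \<noteq> b i \<longrightarrow> a i \<bullet> y \<noteq> b i"
    using assms by (intro eventually_ball_finite) auto
  then show ?thesis by eventually_elim (auto simp: active_def)
qed

text \<open>Active constraints cannot grow along \<open>u\<close>, and the slack of the inactive
  ones survives small steps. Thus tangent directions give actual segments in the polyhedron.\<close>

lemma eventually_feasible_direction:
  assumes fin: "finite K" and x: "x \<in> polyhedral_set a b K"
    and u: "u \<in> T_cone a (active a b K x)"
  shows "\<forall>\<^sub>F t in at_right 0. x + t *\<^sub>R u \<in> polyhedral_set a b K"
proof -
  have "\<forall>\<^sub>F t in at_right 0. a i \<bullet> (x + t *\<^sub>R u) \<le> b i" if i: "i \<in> K" for i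
  proof (cases "i \<in> active a b K x")
    case True
    have "\<forall>\<^sub>F t in at_right (0::real). t > 0" by (rule eventually_at_right_less)
    then show ?thesis
    proof eventually_elim
      case (elim t)
      then have "t * (a i \<bullet> u) \<le> 0"
        using True u by (auto simp: T_cone_def mult_le_0_iff)
      then show ?case using True by (simp add: active_def inner_right_distrib)
    qed
  next
    case False
    then have "a i \<bullet> (x + 0 *\<^sub>R u) < b i"
      using i x by (force simp: active_def polyhedral_set_def)
    moreover have "((\<lambda>t. a i \<bullet> (x + t *\<^sub>R u)) \<longlongrightarrow> a i \<bullet> (x + 0 *\<^sub>R u)) (at_right 0)"
      by (intro tendsto_intros)
    ultimately have "\<forall>\<^sub>F t in at_right 0. a i \<bullet> (x + t *\<^sub>R u) < b i"
      by (rule order_tendstoD(2)[rotated])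
    then show ?thesis by eventually_elim simp
  qed
  then have "\<forall>\<^sub>F t in at_right 0. \<forall>i\<in>K. a i \<bullet> (x + t *\<^sub>R u) \<le> b i"
    using fin by (intro eventually_ball_finite) auto
  then show ?thesis by (simp add: polyhedral_set_def)
qed

section \<open>Normal vectors and their multipliers\<close>

text \<open>Each term with a nonzero multiplier belongs to an active constraint, whose value cannot
  increase from \<open>x\<close> to another feasible point. Multipliers are total functions
  supported in the active set, so that sums at different points run over the same
  \<open>K\<close>.\<close>

lemma sum_in_normal_cone_polyhedral:
  assumes x: "x \<in> polyhedral_set a b K" and nu: "\<And>i. \<nu> i \<ge> 0"
    and supp: "{i. \<nu> i > 0} \<subseteq> active a b K x"
  shows "(\<Sum>i\<in>K. \<nu> i *\<^sub>R a i) \<in> normal_cone_map (polyhedral_set a b K) x"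
proof -
  have "(\<Sum>i\<in>K. \<nu> i *\<^sub>R a i) \<bullet> (y - x) \<le> 0" if y: "y \<in> polyhedral_set a b K" for y
    unfolding inner_sum_left
  proof (rule sum_nonpos)
    fix i assume i: "i \<in> K"
    show "\<nu> i *\<^sub>R a i \<bullet> (y - x) \<le> 0"
    proof (cases "\<nu> i = 0")
      case False
      then have "a i \<bullet> x = b i"
        using supp nu[of i] by (force simp: active_def less_le)
      then have "a i \<bullet> (y - x) \<le> 0"
        using y i by (simp add: inner_diff_right polyhedral_set_def)
      then show ?thesis using nu[of i] by (simp add: mult_nonneg_nonpos)
    qed simp
  qed
  then show ?thesis using x by (simp add: normal_cone_map_def)
qed

text \<open>A normal vector is nonpositive on feasible directions, hence on \<open>B_cone\<close>
  with \<open>P = {}\<close>, which is the tangent cone at \<open>x\<close>; the Farkas property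
  then supplies the coefficients.\<close>

lemma normal_cone_polyhedral_multipliers:
  fixes a :: "nat \<Rightarrow> 'a::euclidean_space"
  assumes fin: "finite K" and v: "v \<in> normal_cone_map (polyhedral_set a b K) x"
    and inj: "inj_on a (active a b K x)" and ind: "independent (a ` active a b K x)"
  shows "\<exists>\<nu>. (\<forall>i. \<nu> i \<ge> 0) \<and> {i. \<nu> i > 0} \<subseteq> active a b K x \<and> v = (\<Sum>i\<in>K. \<nu> i *\<^sub>R a i)"
proof -
  let ?Q = "active a b K x"
  have x: "x \<in> polyhedral_set a b K"
    and vy: "\<And>y. y \<in> polyhedral_set a b K \<Longrightarrow> v \<bullet> (y - x) \<le> 0"
    using v by (auto simp: normal_cone_map_def split: if_splits)
  have "v \<bullet> u \<le> 0" if "u \<in> B_cone a ?Q {}" for u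
  proof -
    have "u \<in> T_cone a ?Q" using that by (simp add: B_cone_def)
    then have "\<forall>\<^sub>F t in at_right 0. t > 0 \<and> x + t *\<^sub>R u \<in> polyhedral_set a b K"
      by (intro eventually_conj eventually_at_right_less eventually_feasible_direction[OF fin x])
    then obtain t where "t > 0" "x + t *\<^sub>R u \<in> polyhedral_set a b K"
      using eventually_happens'[OF trivial_limit_at_right_real] by blast
    then show ?thesis using vy[of "x + t *\<^sub>R u"] by (simp add: mult_le_0_iff)
  qed
  then obtain c where c: "v = (\<Sum>i\<in>?Q. c i *\<^sub>R a i)" "\<forall>i\<in>?Q - {}. c i \<ge> 0"
    using farkas_independent[OF inj ind, of "{}" v] by blast
  \<comment> \<open>Extension by zero makes the sign condition hold at every index and lets the sum
    run over \<open>K\<close>.\<close>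
  let ?nu = "\<lambda>i. if i \<in> ?Q then c i else 0"
  have "v = (\<Sum>i\<in>K. ?nu i *\<^sub>R a i)"
    unfolding c(1) using fin
    by (intro sum.mono_neutral_cong_left) (auto simp: active_def)
  then show ?thesis using c(2) by (intro exI[of _ ?nu]) auto
qed

text \<open>Under linear independence the \<open>j\<close>-th coefficient of \<open>y\<close> is
  \<open>y \<bullet> d\<close> with \<open>d\<close> dual to \<open>a j\<close>, so it depends
  continuously on \<open>y\<close> and stays positive nearby.\<close>

lemma eventually_positive_multipliers:
  fixes a :: "nat \<Rightarrow> 'a::euclidean_space"
  assumes fin: "finite K" and "Q \<subseteq> K" and inj: "inj_on a Q" and ind: "independent (a ` Q)"
    and mu: "{i. \<mu> i \<noteq> 0} \<subseteq> Q"
  shows "\<forall>\<^sub>F y in nhds (\<Sum>i\<in>K. \<mu> i *\<^sub>R a i).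
           \<forall>\<nu>. {i. \<nu> i \<noteq> 0} \<subseteq> Q \<and> y = (\<Sum>i\<in>K. \<nu> i *\<^sub>R a i) \<longrightarrow> (\<forall>i. \<mu> i > 0 \<longrightarrow> \<nu> i > 0)"
proof -
  let ?x = "\<Sum>i\<in>K. \<mu> i *\<^sub>R a i"
  have "\<forall>\<^sub>F y in nhds ?x.
          \<forall>\<nu>. {i. \<nu> i \<noteq> 0} \<subseteq> Q \<and> y = (\<Sum>i\<in>K. \<nu> i *\<^sub>R a i) \<longrightarrow> \<mu> j > 0 \<longrightarrow> \<nu> j > 0"
    if j: "j \<in> Q" for j
  proof (cases "\<mu> j > 0")
    case True
    obtain d where d: "\<forall>i\<in>Q. a i \<bullet> d = (if i = j then 1 else 0)"
      using prescribed_inner_products[OF inj ind, of "\<lambda>i. if i = j then 1 else 0"] by blast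
    have coef: "(\<Sum>i\<in>K. \<nu> i *\<^sub>R a i) \<bullet> d = \<nu> j" if "{i. \<nu> i \<noteq> 0} \<subseteq> Q" for \<nu>
    proof -
      have "(\<Sum>i\<in>K. \<nu> i *\<^sub>R a i) \<bullet> d = (\<Sum>i\<in>K. if i = j then \<nu> i else 0)"
        unfolding inner_sum_left using that d by (intro sum.cong) auto
      then show ?thesis using fin j assms(2) by auto
    qed
    have "((\<lambda>y. y \<bullet> d) \<longlongrightarrow> ?x \<bullet> d) (nhds ?x)" by (intro tendsto_intros filterlim_ident)
    then have "\<forall>\<^sub>F y in nhds ?x. y \<bullet> d > 0"
      using True coef[OF mu] by (intro order_tendstoD(1)) auto
    then show ?thesis by eventually_elim (use coef in auto)
  qed simp
  then have "\<forall>\<^sub>F y in nhds ?x. \<forall>j\<in>Q.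
          \<forall>\<nu>. {i. \<nu> i \<noteq> 0} \<subseteq> Q \<and> y = (\<Sum>i\<in>K. \<nu> i *\<^sub>R a i) \<longrightarrow> \<mu> j > 0 \<longrightarrow> \<nu> j > 0"
    using finite_subset[OF assms(2) fin] by (intro eventually_ball_finite) auto
  then show ?thesis
  proof eventually_elim
    case (elim y)
    show ?case
    proof (intro allI impI)
      fix \<nu> i assume "{i. \<nu> i \<noteq> 0} \<subseteq> Q \<and> y = (\<Sum>i\<in>K. \<nu> i *\<^sub>R a i)" and i: "\<mu> i > 0"
      moreover have "i \<in> Q" using i mu by auto
      ultimately show "\<nu> i > 0" using elim by blast
    qed
  qed
qed

section \<open>Tests for Frechet normals with respect to a set\<close>

text \<open>On the ray \<open>z + t *\<^sub>R d\<close> with \<open>t > 0\<close> the difference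
  quotient has the constant value \<open>v \<bullet> d / norm d\<close>. A positive value would
  contradict the bound on the upper limit.\<close>

lemma frechet_normal_wrt_direction:
  fixes v d :: "'a::real_inner"
  assumes v: "v \<in> frechet_normal_wrt D z \<Omega>"
    and ev: "\<forall>\<^sub>F t in at_right 0. z + t *\<^sub>R d \<in> \<Omega> \<inter> D"
  shows "v \<bullet> d \<le> 0"
proof (rule ccontr)
  assume "\<not> v \<bullet> d \<le> 0"
  then have pos: "v \<bullet> d > 0" and d0: "d \<noteq> 0" by auto
  define c where "c = v \<bullet> d / norm d"
  have c: "c > 0" using pos d0 by (simp add: c_def)
  have "Limsup (at z within (\<Omega> \<inter> D)) (\<lambda>y. ereal (v \<bullet> (y - z) / norm (y - z))) \<le> 0"
    using v by (simp add: frechet_normal_wrt_def)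
  then have "\<forall>\<^sub>F y in at z within (\<Omega> \<inter> D). ereal (v \<bullet> (y - z) / norm (y - z)) < ereal c"
    using c unfolding Limsup_le_iff by (metis ereal_less(2))
  moreover have "filterlim (\<lambda>t. z + t *\<^sub>R d) (at z within (\<Omega> \<inter> D)) (at_right 0)"
    unfolding filterlim_at
  proof
    have "\<forall>\<^sub>F t in at_right (0::real). t > 0" by (rule eventually_at_right_less)
    then show "\<forall>\<^sub>F t in at_right 0. z + t *\<^sub>R d \<in> \<Omega> \<inter> D \<and> z + t *\<^sub>R d \<noteq> z"
      using ev by eventually_elim (use d0 in auto)
    have "((\<lambda>t. z + t *\<^sub>R d) \<longlongrightarrow> z + 0 *\<^sub>R d) (at_right 0)" by (intro tendsto_intros)
    then show "((\<lambda>t. z + t *\<^sub>R d) \<longlongrightarrow> z) (at_right 0)" by simp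
  qed
  ultimately have "\<forall>\<^sub>F t in at_right 0.
      ereal (v \<bullet> (z + t *\<^sub>R d - z) / norm (z + t *\<^sub>R d - z)) < ereal c"
    by (rule eventually_compose_filterlim)
  then have "\<forall>\<^sub>F t in at_right 0. t > 0 \<and>
      ereal (v \<bullet> (z + t *\<^sub>R d - z) / norm (z + t *\<^sub>R d - z)) < ereal c"
    by (intro eventually_conj eventually_at_right_less)
  then obtain t where t: "t > 0" "v \<bullet> (z + t *\<^sub>R d - z) / norm (z + t *\<^sub>R d - z) < c"
    using eventually_happens'[OF trivial_limit_at_right_real] by fastforce
  then show False by (simp add: c_def)
qed

text \<open>A nonpositive numerator on a whole neighbourhood bounds the upper limit without any
  estimate of the quotient.\<close>

lemma frechet_normal_wrtI:
  assumes "p > 0" and "z + p *\<^sub>R v \<in> D"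
    and ev: "\<forall>\<^sub>F y in nhds z. y \<in> \<Omega> \<inter> D \<longrightarrow> v \<bullet> (y - z) \<le> 0"
  shows "v \<in> frechet_normal_wrt D z \<Omega>"
proof -
  have "\<forall>\<^sub>F y in at z within (\<Omega> \<inter> D). ereal (v \<bullet> (y - z) / norm (y - z)) \<le> 0"
    using ev unfolding eventually_at_filter by eventually_elim (auto simp: divide_nonpos_nonneg)
  then have "Limsup (at z within (\<Omega> \<inter> D)) (\<lambda>y. ereal (v \<bullet> (y - z) / norm (y - z))) \<le> 0"
    by (rule Limsup_bounded)
  then show ?thesis using assms(1,2) by (auto simp: frechet_normal_wrt_def)
qed

section \<open>The Frechet normal cone to the graph\<close>

text \<open>Necessity tests a normal along segments of the graph on which only one component moves.
  For sufficiency the inner product with a nearby displacement splits into two parts, one per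
  component, and each is nonpositive.\<close>

lemma frechet_normal_wrt_gph_normal_cone_map:
  fixes a :: "nat \<Rightarrow> 'a::euclidean_space"
  assumes fin: "finite I1" "finite I2" and disj: "I1 \<inter> I2 = {}"
    and xT: "x \<in> polyhedral_set a b I1" and xC: "x \<in> polyhedral_set a (\<lambda>_. 0) I2"
    and Q: "Q = active a b I1 x \<union> active a (\<lambda>_. 0) I2 x"
    and inj: "inj_on a Q" and ind: "independent (a ` Q)"
    and mu0: "\<And>i. \<mu> i \<ge> 0" and P: "P = {i. \<mu> i > 0}" and PQ: "P \<subseteq> Q \<inter> I1"
    and xs: "xs = (\<Sum>i\<in>I1. \<mu> i *\<^sub>R a i)"
  shows "frechet_normal_wrt (polyhedral_set a (\<lambda>_. 0) I2 \<times> UNIV) (x, xs)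
           (gph (normal_cone_map (polyhedral_set a b I1)))
         = (A_cone a Q P \<inter> T_cone a (Q \<inter> I2)) \<times> B_cone a (Q \<inter> I1) P"
    (is "frechet_normal_wrt (?C \<times> UNIV) _ (gph (normal_cone_map ?T)) = _")
proof (intro equalityI subrelI)
  have Q1: "Q \<inter> I1 = active a b I1 x" and Q2: "Q \<inter> I2 = active a (\<lambda>_. 0) I2 x"
    using disj by (auto simp: Q active_def)
  have PQ': "P \<subseteq> Q" using PQ by blast
  have inj1: "inj_on a (Q \<inter> I1)" using inj by (rule inj_on_subset) auto
  have ind1: "independent (a ` (Q \<inter> I1))" using ind by (rule independent_mono) auto
  {
    fix w w' assume F: "(w, w') \<in> frechet_normal_wrt (?C \<times> UNIV) (x, xs) (gph (normal_cone_map ?T))"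
    note dir = frechet_normal_wrt_direction[OF F]
    have "w \<bullet> u \<le> 0" if u: "u \<in> B_cone a Q P" for u
    proof -
      have "\<forall>\<^sub>F t in at_right 0. x + t *\<^sub>R u \<in> ?T"
        using u Q1 by (intro eventually_feasible_direction[OF fin(1) xT]) (auto simp: B_cone_def T_cone_def)
      moreover have "\<forall>\<^sub>F t in at_right 0. x + t *\<^sub>R u \<in> ?C"
        using u Q2 by (intro eventually_feasible_direction[OF fin(2) xC]) (auto simp: B_cone_def T_cone_def)
      ultimately have "\<forall>\<^sub>F t in at_right 0. (x, xs) + t *\<^sub>R (u, 0) \<in> gph (normal_cone_map ?T) \<inter> ?C \<times> UNIV"
      proof eventually_elim
        case (elim t)
        \<comment> \<open>The vector \<open>u\<close> is orthogonal to \<open>a i\<close> for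
          \<open>i\<close> in \<open>P\<close>, so these constraints stay active and the multipliers
          of \<open>xs\<close> remain valid at the shifted point.\<close>
        have "P \<subseteq> active a b I1 (x + t *\<^sub>R u)"
          using PQ u Q1 by (auto simp: active_def B_cone_def inner_right_distrib)
        then have "xs \<in> normal_cone_map ?T (x + t *\<^sub>R u)"
          unfolding xs using P mu0 elim(1) by (intro sum_in_normal_cone_polyhedral) auto
        then show ?case using elim by (simp add: gph_def)
      qed
      then show ?thesis using dir[of "(u, 0)"] by simp
    qed
    then have "w \<in> A_cone a Q P" using A_cone_eq_polar_B_cone[OF inj ind PQ'] by blast
    moreover have "w \<in> T_cone a (Q \<inter> I2)"
    proof -
      \<comment> \<open>The factor \<open>T_cone a (Q \<inter> I2)\<close> comes from the side
        condition \<open>x + p *\<^sub>R w\<close> in the cone, read at the constraints whose value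
        at \<open>x\<close> is zero.\<close>
      obtain p where "p > 0" "x + p *\<^sub>R w \<in> ?C"
        using F by (auto simp: frechet_normal_wrt_def)
      then show ?thesis
        by (auto simp: T_cone_def Q2 active_def polyhedral_set_def inner_right_distrib mult_le_0_iff)
    qed
    moreover
    \<comment> \<open>With \<open>x\<close> fixed, a single multiplier changes at rate
      \<open>s\<close>. Increase (\<open>s = 1\<close>) is possible at every index of
      \<open>Q \<inter> I1\<close>, decrease (\<open>s = -1\<close>) at those of \<open>P\<close>,
      which yields inequalities and equalities respectively.\<close>
    have step: "w' \<bullet> (s *\<^sub>R a i) \<le> 0"
      if i: "i \<in> Q \<inter> I1" and s: "\<forall>\<^sub>F t in at_right 0. \<mu> i + t * s \<ge> 0" for i s
    proof -
      have "\<forall>\<^sub>F t in at_right 0. (x, xs) + t *\<^sub>R (0, s *\<^sub>R a i) \<in> gph (normal_cone_map ?T) \<inter> ?C \<times> UNIV"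
        using s
      proof eventually_elim
        case (elim t)
        let ?nu = "\<mu>(i := \<mu> i + t * s)"
        have "{j. ?nu j > 0} \<subseteq> active a b I1 x" "\<And>j. ?nu j \<ge> 0"
          using P PQ Q1 i mu0 elim by auto
        then have "(\<Sum>j\<in>I1. ?nu j *\<^sub>R a j) \<in> normal_cone_map ?T x"
          by (intro sum_in_normal_cone_polyhedral xT)
        moreover have "(\<Sum>j\<in>I1. ?nu j *\<^sub>R a j) = xs + t *\<^sub>R s *\<^sub>R a i"
        proof -
          have "(\<Sum>j\<in>I1. ?nu j *\<^sub>R a j) = (\<Sum>j\<in>I1. \<mu> j *\<^sub>R a j + (if j = i then (t * s) *\<^sub>R a j else 0))"
            by (intro sum.cong) (auto simp: scaleR_left_distrib)
          then show ?thesis using fin i by (simp add: xs sum.distrib)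
        qed
        ultimately show ?case using xC by (simp add: gph_def)
      qed
      then show ?thesis using dir[of "(0, s *\<^sub>R a i)"] by simp
    qed
    have "w' \<bullet> a i \<le> 0" if i: "i \<in> Q \<inter> I1" for i
    proof -
      have "\<forall>\<^sub>F t in at_right (0::real). t > 0" by (rule eventually_at_right_less)
      then have "\<forall>\<^sub>F t in at_right 0. \<mu> i + t * 1 \<ge> 0"
        by eventually_elim (use mu0[of i] in simp)
      then show ?thesis using step[OF i, of 1] by simp
    qed
    moreover have "w' \<bullet> a i \<ge> 0" if i: "i \<in> P" for i
    proof -
      have "((\<lambda>t. \<mu> i + t * (-1)) \<longlongrightarrow> \<mu> i + 0 * (-1)) (at_right 0)" by (intro tendsto_intros)
      then have "\<forall>\<^sub>F t in at_right 0. \<mu> i + t * (-1) > 0"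
        using i P by (intro order_tendstoD(1)) auto
      then have "\<forall>\<^sub>F t in at_right 0. \<mu> i + t * (-1) \<ge> 0" by eventually_elim simp
      then show ?thesis using step[of i "-1"] i PQ by auto
    qed
    ultimately have "w' \<in> B_cone a (Q \<inter> I1) P"
      using PQ by (fastforce simp: B_cone_def T_cone_def inner_commute intro: antisym)
    with \<open>w \<in> A_cone a Q P\<close> \<open>w \<in> T_cone a (Q \<inter> I2)\<close>
    show "(w, w') \<in> (A_cone a Q P \<inter> T_cone a (Q \<inter> I2)) \<times> B_cone a (Q \<inter> I1) P" by blast
  }
  {
    fix w w' assume "(w, w') \<in> (A_cone a Q P \<inter> T_cone a (Q \<inter> I2)) \<times> B_cone a (Q \<inter> I1) P"
    then have wA: "w \<in> A_cone a Q P" and wT: "w \<in> T_cone a (Q \<inter> I2)"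
      and w'B: "w' \<in> B_cone a (Q \<inter> I1) P" by auto
    have "\<forall>\<^sub>F t in at_right 0. t > 0 \<and> x + t *\<^sub>R w \<in> ?C"
      using wT Q2
      by (intro eventually_conj eventually_at_right_less eventually_feasible_direction[OF fin(2) xC]) simp
    then obtain p where p: "p > 0" "x + p *\<^sub>R w \<in> ?C"
      using eventually_happens'[OF trivial_limit_at_right_real] by blast
    have ev_act: "\<forall>\<^sub>F y in nhds x. active a b I1 y \<subseteq> Q \<inter> I1"
      unfolding Q1 by (rule eventually_active_subset[OF fin(1)])
    have ev_mult: "\<forall>\<^sub>F y in nhds xs. \<forall>\<nu>. {i. \<nu> i \<noteq> 0} \<subseteq> Q \<inter> I1 \<and> y = (\<Sum>i\<in>I1. \<nu> i *\<^sub>R a i)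
        \<longrightarrow> (\<forall>i. \<mu> i > 0 \<longrightarrow> \<nu> i > 0)"
      unfolding xs
    proof (rule eventually_positive_multipliers[OF fin(1) _ inj1 ind1])
      show "{i. \<mu> i \<noteq> 0} \<subseteq> Q \<inter> I1"
        using P PQ mu0 by (auto simp: less_le)
    qed simp
    \<comment> \<open>The product filter combines control of the active set, near \<open>x\<close>,
      with control of the multipliers, near \<open>xs\<close>.\<close>
    have "\<forall>\<^sub>F z in nhds x \<times>\<^sub>F nhds xs. z \<in> gph (normal_cone_map ?T) \<inter> ?C \<times> UNIV
        \<longrightarrow> (w, w') \<bullet> (z - (x, xs)) \<le> 0"
      using eventually_prodI[OF ev_act ev_mult]
    proof eventually_elim
      case (elim z)
      show ?case
      proof
        assume z: "z \<in> gph (normal_cone_map ?T) \<inter> ?C \<times> UNIV"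
        obtain y ys where [simp]: "z = (y, ys)" by (cases z)
        have ys: "ys \<in> normal_cone_map ?T y" and yC: "y \<in> ?C" using z by (auto simp: gph_def)
        then have yT: "y \<in> ?T" by (auto simp: normal_cone_map_def split: if_splits)
        have sub: "active a b I1 y \<subseteq> Q \<inter> I1" using elim by simp
        obtain \<nu> where nu: "\<forall>i. \<nu> i \<ge> 0" "{i. \<nu> i > 0} \<subseteq> active a b I1 y"
            "ys = (\<Sum>i\<in>I1. \<nu> i *\<^sub>R a i)"
          using normal_cone_polyhedral_multipliers[OF fin(1) ys inj_on_subset[OF inj1 sub]
              independent_mono[OF ind1 image_mono[OF sub]]] by blast
        have nuQ: "{i. \<nu> i \<noteq> 0} \<subseteq> Q \<inter> I1"
          using nu sub by (auto simp: less_le)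
        \<comment> \<open>Multipliers positive at \<open>xs\<close> stay positive at
          \<open>ys\<close>, and a positive multiplier forces its constraint to be active at
          \<open>y\<close>. This gives the equalities that put \<open>y - x\<close> into
          \<open>B_cone a Q P\<close>.\<close>
        have Pact: "P \<subseteq> active a b I1 y"
          using elim nuQ nu P by auto
        have "y - x \<in> B_cone a Q P"
        proof -
          have "a i \<bullet> (y - x) \<le> 0" if "i \<in> Q" for i
            using that yT yC by (auto simp: Q active_def polyhedral_set_def inner_diff_right)
          moreover have "a i \<bullet> (y - x) = 0" if "i \<in> P" for i
            using subsetD[OF Pact that] subsetD[OF PQ that] Q1 by (simp add: active_def inner_diff_right)
          ultimately show ?thesis by (simp add: B_cone_def T_cone_def)
        qed
        then have 1: "w \<bullet> (y - x) \<le> 0"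
          using wA A_cone_eq_polar_B_cone[OF inj ind PQ'] by blast
        \<comment> \<open>The second component splits again: \<open>ys\<close> pairs nonpositively
          with \<open>w'\<close>, whereas \<open>xs\<close> is orthogonal to \<open>w'\<close>
          because its support \<open>P\<close> is.\<close>
        have "\<nu> i * (a i \<bullet> w') \<le> 0" if "i \<in> I1" for i
          using subsetD[OF nuQ, of i] nu(1) w'B
          by (cases "\<nu> i = 0") (auto simp: B_cone_def T_cone_def mult_nonneg_nonpos)
        then have "ys \<bullet> w' \<le> 0"
          unfolding nu(3) inner_sum_left by (intro sum_nonpos) simp
        moreover have "\<mu> i * (a i \<bullet> w') = 0" for i
          using w'B P mu0[of i] by (cases "\<mu> i = 0") (auto simp: B_cone_def)
        then have "xs \<bullet> w' = 0"
          unfolding xs inner_sum_left by (intro sum.neutral) simp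
        ultimately have "w' \<bullet> (ys - xs) \<le> 0" by (simp add: inner_diff_right inner_commute)
        with 1 show "(w, w') \<bullet> (z - (x, xs)) \<le> 0" by simp
      qed
    qed
    then have "\<forall>\<^sub>F z in nhds (x, xs). z \<in> gph (normal_cone_map ?T) \<inter> ?C \<times> UNIV
        \<longrightarrow> (w, w') \<bullet> (z - (x, xs)) \<le> 0"
      by (simp add: nhds_prod)
    then show "(w, w') \<in> frechet_normal_wrt (?C \<times> UNIV) (x, xs) (gph (normal_cone_map ?T))"
      using p by (intro frechet_normal_wrtI[of p]) auto
  }
qed

section \<open>The limiting normal cone: upper bound and attainment\<close>

theorem theorem3p3:
  fixes a :: "nat \<Rightarrow> real ^ 'n" and b :: "nat \<Rightarrow> real" and l1 l :: nat
    and I1 I2 Ibar J Itilde :: "nat set" and lam :: "nat \<Rightarrow> real"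
    and \<Theta> C :: "(real ^ 'n) set" and xbar xstar :: "real ^ 'n"
  assumes "l1 \<le> l"
    and "I1 = {1..l1}" and "I2 = {l1 + 1..l}"
    and "\<Theta> = polyhedral_set a b I1"
    and "C = polyhedral_set a (\<lambda>_. 0) I2"
    and "xbar \<in> C" and "(xbar, xstar) \<in> gph (normal_cone_map \<Theta>)"
    and "Ibar = active a b I1 xbar \<union> active a (\<lambda>_. 0) I2 xbar"
    and "inj_on a Ibar" and "independent (a ` Ibar)"
    and "J \<subseteq> active a b I1 xbar" and "\<forall>i\<in>J. lam i \<ge> 0"
    and "xstar = (\<Sum>i\<in>J. lam i *\<^sub>R a i)"
    and "Itilde = {i\<in>J. lam i > 0}"
  shows "limiting_normal_wrt (C \<times> UNIV) (xbar, xstar) (gph (normal_cone_map \<Theta>)) =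
    (\<Union>(Q, P) \<in> {(Q, P). Q \<subseteq> Ibar \<and> Itilde \<subseteq> P \<and> P \<subseteq> Q \<inter> I1}.
       (A_cone a Q P \<inter> T_cone a (Q \<inter> I2)) \<times> B_cone a (Q \<inter> I1) P)"
proof -
  have fin: "finite I1" "finite I2" and disj: "I1 \<inter> I2 = {}"
    using assms(2,3) by auto
  note Ibar = assms(8) and inj = assms(9) and ind = assms(10)
  have Ibar1: "Ibar \<inter> I1 = active a b I1 xbar"
    using disj by (auto simp: Ibar active_def)
  have inj1: "inj_on a (Ibar \<inter> I1)" using inj by (rule inj_on_subset) auto
  have ind1: "independent (a ` (Ibar \<inter> I1))" using ind by (rule independent_mono) auto
  have finIbar: "finite Ibar" using finite_independent_family[OF inj ind] .
  have xT: "xbar \<in> \<Theta>"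
    using assms(7) by (auto simp: gph_def normal_cone_map_def split: if_splits)
  \<comment> \<open>Extended by zero, the fixed representation of \<open>xstar\<close> has
    \<open>Itilde\<close> as its set of positive indices.\<close>
  define \<mu> where "\<mu> i = (if i \<in> J then lam i else 0)" for i
  have mu0: "\<mu> i \<ge> 0" for i using assms(12) by (simp add: \<mu>_def)
  have Itilde: "Itilde = {i. \<mu> i > 0}" by (auto simp: \<mu>_def assms(14))
  have muI: "{i. \<mu> i \<noteq> 0} \<subseteq> Ibar \<inter> I1" using assms(11) by (auto simp: \<mu>_def Ibar1)
  have xs: "xstar = (\<Sum>i\<in>I1. \<mu> i *\<^sub>R a i)"
    unfolding assms(13) using fin assms(11)
    by (intro sum.mono_neutral_cong_left) (auto simp: \<mu>_def active_def)
  define S where "S = {(Q, P). Q \<subseteq> Ibar \<and> Itilde \<subseteq> P \<and> P \<subseteq> Q \<inter> I1}"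
  define F where "F Q P = (A_cone a Q P \<inter> T_cone a (Q \<inter> I2)) \<times> B_cone a (Q \<inter> I1) P" for Q P
  let ?G = "gph (normal_cone_map \<Theta>)"
  have "limiting_normal_wrt (C \<times> UNIV) (xbar, xstar) ?G = (\<Union>(Q, P)\<in>S. F Q P)"
  proof (intro equalityI subsetI)
    fix v assume "v \<in> limiting_normal_wrt (C \<times> UNIV) (xbar, xstar) ?G"
    then obtain zs vs where z: "\<And>k. zs k \<in> ?G \<inter> C \<times> UNIV"
        and vs: "\<And>k. vs k \<in> frechet_normal_wrt (C \<times> UNIV) (zs k) ?G"
        and lim: "zs \<longlonglongrightarrow> (xbar, xstar)" "vs \<longlonglongrightarrow> v"
      unfolding limiting_normal_wrt_def by blast
    \<comment> \<open>A finite union of closed cones is closed, so it suffices that the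
      approximating normals \<open>vs k\<close> eventually lie in the union.\<close>
    have "finite S"
    proof (rule finite_subset)
      show "S \<subseteq> Pow Ibar \<times> Pow Ibar" by (auto simp: S_def)
    qed (use finIbar in simp)
    moreover have "closed (F Q P)" if "(Q, P) \<in> S" for Q P
    proof -
      have "Q \<subseteq> Ibar" "P \<subseteq> Q" using that by (auto simp: S_def)
      then show ?thesis unfolding F_def
        by (intro closed_Times closed_Int closed_A_cone closed_T_cone closed_B_cone
            inj_on_subset[OF inj] independent_mono[OF ind]) auto
    qed
    ultimately have "closed (\<Union>(Q, P)\<in>S. F Q P)" by (intro closed_UN) auto
    moreover have "\<forall>\<^sub>F k in sequentially. vs k \<in> (\<Union>(Q, P)\<in>S. F Q P)"
    proof -
      have limx: "(\<lambda>k. fst (zs k)) \<longlonglongrightarrow> xbar" and limxs: "(\<lambda>k. snd (zs k)) \<longlonglongrightarrow> xstar"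
        using tendsto_fst[OF lim(1)] tendsto_snd[OF lim(1)] by simp_all
      have "\<forall>\<^sub>F k in sequentially. active a b I1 (fst (zs k)) \<subseteq> active a b I1 xbar"
        using eventually_compose_filterlim[OF eventually_active_subset[OF fin(1)] limx] .
      moreover have "\<forall>\<^sub>F k in sequentially.
          active a (\<lambda>_. 0) I2 (fst (zs k)) \<subseteq> active a (\<lambda>_. 0) I2 xbar"
        using eventually_compose_filterlim[OF eventually_active_subset[OF fin(2)] limx] .
      moreover have "\<forall>\<^sub>F k in sequentially. \<forall>\<nu>. {i. \<nu> i \<noteq> 0} \<subseteq> Ibar \<inter> I1 \<and>
          snd (zs k) = (\<Sum>i\<in>I1. \<nu> i *\<^sub>R a i) \<longrightarrow> (\<forall>i. \<mu> i > 0 \<longrightarrow> \<nu> i > 0)"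
        using eventually_compose_filterlim[OF
            eventually_positive_multipliers[OF fin(1) _ inj1 ind1 muI] limxs[unfolded xs]] by simp
      ultimately show ?thesis
      proof eventually_elim
        case (elim k)
        obtain x y where zk: "zs k = (x, y)" by (cases "zs k")
        have y: "y \<in> normal_cone_map (polyhedral_set a b I1) x"
          and xC: "x \<in> polyhedral_set a (\<lambda>_. 0) I2"
          using z[of k] zk assms(4,5) by (auto simp: gph_def)
        have xT: "x \<in> polyhedral_set a b I1"
          using y by (auto simp: normal_cone_map_def split: if_splits)
        \<comment> \<open>The pair \<open>(Q, P)\<close> may vary with \<open>k\<close>: all active
          indices at \<open>x\<close>, and the indices with positive multiplier at
          \<open>y\<close>.\<close>
        define Q where "Q = active a b I1 x \<union> active a (\<lambda>_. 0) I2 x"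
        have QI: "Q \<subseteq> Ibar" using elim(1,2) zk by (auto simp: Q_def Ibar)
        have sub: "active a b I1 x \<subseteq> Ibar \<inter> I1" using elim(1) zk Ibar1 by simp
        obtain \<nu> where nu: "\<forall>i. \<nu> i \<ge> 0" "{i. \<nu> i > 0} \<subseteq> active a b I1 x"
            "y = (\<Sum>i\<in>I1. \<nu> i *\<^sub>R a i)"
          using normal_cone_polyhedral_multipliers[OF fin(1) y inj_on_subset[OF inj1 sub]
              independent_mono[OF ind1 image_mono[OF sub]]] by blast
        have "{i. \<nu> i \<noteq> 0} \<subseteq> Ibar \<inter> I1" using nu sub by (auto simp: less_le)
        \<comment> \<open>Multipliers positive at the reference point remain positive along the
          sequence, hence the lower bound \<open>Itilde\<close> on \<open>P\<close>.\<close>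
        then have "Itilde \<subseteq> {i. \<nu> i > 0}"
          using elim(3) nu(3) zk Itilde by auto
        moreover have PQ: "{i. \<nu> i > 0} \<subseteq> Q \<inter> I1"
          using nu(2) by (auto simp: Q_def active_def)
        ultimately have "(Q, {i. \<nu> i > 0}) \<in> S" using QI by (simp add: S_def)
        moreover have "vs k \<in> F Q {i. \<nu> i > 0}"
          using vs[of k] frechet_normal_wrt_gph_normal_cone_map[OF fin disj xT xC Q_def
              inj_on_subset[OF inj QI] independent_mono[OF ind image_mono[OF QI]] _ refl PQ nu(3)]
            nu(1) zk assms(4,5) by (simp add: F_def)
        ultimately show ?case by blast
      qed
    qed
    ultimately show "v \<in> (\<Union>(Q, P)\<in>S. F Q P)"
      using lim(2) by (intro Lim_in_closed_set) auto
  next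
    fix v assume "v \<in> (\<Union>(Q, P)\<in>S. F Q P)"
    then obtain Q P where QI: "Q \<subseteq> Ibar" and IP: "Itilde \<subseteq> P" and PQ: "P \<subseteq> Q \<inter> I1" and v: "v \<in> F Q P"
      by (auto simp: S_def)
    \<comment> \<open>A move along \<open>d\<close> keeps the constraints in \<open>Q\<close> active
      and makes the others of \<open>Ibar\<close> strict.\<close>
    obtain d where d: "\<forall>i\<in>Ibar. a i \<bullet> d = (if i \<in> Q then 0 else -1)"
      using prescribed_inner_products[OF inj ind, of "\<lambda>i. if i \<in> Q then 0 else -1"] by blast
    \<comment> \<open>Adding \<open>t *\<^sub>R e\<close> raises exactly the multipliers in
      \<open>P\<close> by \<open>t\<close>. As \<open>Itilde\<close> is contained in
      \<open>P\<close>, the positive ones become precisely those in \<open>P\<close>.\<close>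
    define e where "e = (\<Sum>i\<in>I1. (if i \<in> P then 1 else 0) *\<^sub>R a i)"
    \<comment> \<open>The same \<open>v\<close> is a Frechet normal at all these points, so a
      constant sequence of normals will do.\<close>
    have good: "\<forall>\<^sub>F t in at_right 0. (xbar + t *\<^sub>R d, xstar + t *\<^sub>R e) \<in> ?G \<inter> C \<times> UNIV \<and>
        v \<in> frechet_normal_wrt (C \<times> UNIV) (xbar + t *\<^sub>R d, xstar + t *\<^sub>R e) ?G"
    proof -
      have limd: "filterlim (\<lambda>t. xbar + t *\<^sub>R d) (nhds xbar) (at_right 0)"
      proof -
        have "((\<lambda>t. xbar + t *\<^sub>R d) \<longlongrightarrow> xbar + 0 *\<^sub>R d) (at_right 0)" by (intro tendsto_intros)
        then show ?thesis by simp
      qed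
      have "\<forall>\<^sub>F t in at_right (0::real). t > 0" by (rule eventually_at_right_less)
      moreover have "\<forall>\<^sub>F t in at_right 0. xbar + t *\<^sub>R d \<in> polyhedral_set a b I1"
        using xT assms(4) d
        by (intro eventually_feasible_direction fin) (auto simp: T_cone_def Ibar)
      moreover have "\<forall>\<^sub>F t in at_right 0. xbar + t *\<^sub>R d \<in> polyhedral_set a (\<lambda>_. 0) I2"
        using assms(5,6) d
        by (intro eventually_feasible_direction fin) (auto simp: T_cone_def Ibar)
      moreover have "\<forall>\<^sub>F t in at_right 0. active a b I1 (xbar + t *\<^sub>R d) \<subseteq> active a b I1 xbar"
        using eventually_compose_filterlim[OF eventually_active_subset[OF fin(1)] limd] .
      moreover have "\<forall>\<^sub>F t in at_right 0.
          active a (\<lambda>_. 0) I2 (xbar + t *\<^sub>R d) \<subseteq> active a (\<lambda>_. 0) I2 xbar"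
        using eventually_compose_filterlim[OF eventually_active_subset[OF fin(2)] limd] .
      ultimately show ?thesis
      proof eventually_elim
        case (elim t)
        let ?x = "xbar + t *\<^sub>R d" and ?y = "xstar + t *\<^sub>R e"
        define \<nu> where "\<nu> i = \<mu> i + (if i \<in> P then t else 0)" for i
        have nu0: "\<nu> i \<ge> 0" for i using mu0[of i] elim(1) by (simp add: \<nu>_def)
        have Peq: "P = {i. \<nu> i > 0}"
        proof -
          have "\<nu> i > 0 \<longleftrightarrow> i \<in> P" for i
            using mu0[of i] elim(1) IP by (force simp: \<nu>_def Itilde less_le)
          then show ?thesis by blast
        qed
        have y: "?y = (\<Sum>i\<in>I1. \<nu> i *\<^sub>R a i)"
          unfolding xs e_def \<nu>_def scaleR_sum_right sum.distrib[symmetric]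
          by (intro sum.cong) (auto simp: scaleR_left_distrib)
        have Q: "Q = active a b I1 ?x \<union> active a (\<lambda>_. 0) I2 ?x" (is "Q = ?R")
        proof
          show "Q \<subseteq> ?R"
            using QI d by (auto simp: Ibar active_def inner_right_distrib subset_iff)
          show "?R \<subseteq> Q"
          proof
            fix i assume i: "i \<in> ?R"
            \<comment> \<open>Both points attain the same bound at \<open>i\<close>, so
              \<open>t * (a i \<bullet> d) = 0\<close>, which excludes the value \<open>-1\<close>
              taken outside \<open>Q\<close>.\<close>
            then have "i \<in> Ibar" "a i \<bullet> ?x = a i \<bullet> xbar"
              using elim(4,5) by (auto simp: Ibar active_def)
            then show "i \<in> Q" using d elim(1) by (auto simp: inner_right_distrib split: if_splits)
          qed
        qed
        have Pact: "{i. \<nu> i > 0} \<subseteq> active a b I1 ?x"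
          using PQ disj Peq Q by (auto simp: active_def)
        have "?y \<in> normal_cone_map (polyhedral_set a b I1) ?x"
          unfolding y using Pact nu0 elim(2) by (intro sum_in_normal_cone_polyhedral)
        then have "(?x, ?y) \<in> ?G \<inter> C \<times> UNIV"
          using elim(3) assms(4,5) by (simp add: gph_def)
        moreover have "v \<in> frechet_normal_wrt (C \<times> UNIV) (?x, ?y) ?G"
          using v frechet_normal_wrt_gph_normal_cone_map[OF fin disj elim(2,3) Q
              inj_on_subset[OF inj QI] independent_mono[OF ind image_mono[OF QI]] nu0 Peq PQ y]
            assms(4,5) by (simp add: F_def)
        ultimately show ?case by blast
      qed
    qed
    obtain T where T: "T > 0"
      "\<And>t. 0 < t \<Longrightarrow> t < T \<Longrightarrow> (xbar + t *\<^sub>R d, xstar + t *\<^sub>R e) \<in> ?G \<inter> C \<times> UNIV \<and>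
        v \<in> frechet_normal_wrt (C \<times> UNIV) (xbar + t *\<^sub>R d, xstar + t *\<^sub>R e) ?G"
      using good unfolding eventually_at_right_field by blast
    \<comment> \<open>The offset \<open>2\<close> keeps \<open>\<tau> k\<close> strictly below
      \<open>T\<close> already for \<open>k = 0\<close>.\<close>
    define \<tau> where "\<tau> k = T / (2 + real k)" for k
    have tau: "0 < \<tau> k" "\<tau> k < T" for k
      using T(1) by (simp_all add: \<tau>_def divide_less_eq)
    have "filterlim (\<lambda>k. 2 + real k) at_top sequentially"
      by (rule filterlim_tendsto_add_at_top[OF tendsto_const filterlim_real_sequentially])
    then have "\<tau> \<longlonglongrightarrow> 0"
      unfolding \<tau>_def by (rule real_tendsto_divide_at_top[OF tendsto_const])
    then have "(\<lambda>k. (xbar + \<tau> k *\<^sub>R d, xstar + \<tau> k *\<^sub>R e)) \<longlonglongrightarrow> (xbar + 0 *\<^sub>R d, xstar + 0 *\<^sub>R e)"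
      by (intro tendsto_Pair tendsto_add tendsto_scaleR tendsto_const)
    then have lim: "(\<lambda>k. (xbar + \<tau> k *\<^sub>R d, xstar + \<tau> k *\<^sub>R e)) \<longlonglongrightarrow> (xbar, xstar)" by simp
    have "\<forall>k. (xbar + \<tau> k *\<^sub>R d, xstar + \<tau> k *\<^sub>R e) \<in> ?G \<inter> C \<times> UNIV \<and>
        v \<in> frechet_normal_wrt (C \<times> UNIV) (xbar + \<tau> k *\<^sub>R d, xstar + \<tau> k *\<^sub>R e) ?G"
      using T(2) tau by blast
    with lim tendsto_const[of v]
    show "v \<in> limiting_normal_wrt (C \<times> UNIV) (xbar, xstar) ?G"
      unfolding limiting_normal_wrt_def
      by (intro CollectI exI[of _ "\<lambda>k. (xbar + \<tau> k *\<^sub>R d, xstar + \<tau> k *\<^sub>R e)"]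
          exI[of _ "\<lambda>_. v"] conjI) simp_all
  qed
  then show ?thesis by (simp add: S_def F_def)
qed

end
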